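(* Let $p\ge 2$ be an integer. The generating functions of $C_{\Gamma_n^{(p)}}(x)$ and $D_{\Gamma_n^{(p)}}(x,q)$ are, as formal power series in $t$, $$\sum_{n\geq 0}C_{\Gamma_n^{(p)}}(x)\,t^n=\frac{1+(x+1)t+(x+1)^2t^2+\ldots+(x+1)^{p-1}t^{p-1}}{1-t\left(1+(x+1)t+(x+1)^2t^2+\ldots+ (x+1)^{p-1}t^{p-1}\right)}$$ and $$\sum_{n\geq 0}D_{\Gamma_n^{(p)}}(x,q)\,t^n=\frac{1+(x+q)t+(x+q)^2t^2+\ldots+(x+q)^{p-1}t^{p-1}}{1-t\left(1+(x+q)t+(x+q)^2t^2+\ldots+ (x+q)^{p-1}t^{p-1}\right)}.$$
   Context: For an integer $n\ge 0$, the hypercube $Q_n$ has vertex set $\{0,1\}^n$ (binary strings of length $n$; for $n=0$ only the empty string), two strings being adjacent iff they differ in exactly one coordinate. For $p\ge2$, a $p$-th order Fibonacci string is a binary string that does not contain $1^p$ ($p$ consecutive 1s) as a substring (of consecutive letters). $\Gamma_n^{(p)}$ is the subgraph of $Q_n$ induced by the $p$-th order Fibonacci strings of length $n$; in particular $\Gamma_0^{(p)}=K_1$. The weight of a binary string is its number of 1s. For a graph $G$, $c_k(G)$ is the number of induced subgraphs of $G$ isomorphic to $Q_k$, and the cube polynomial is $C_G(x)=\sum_{k\ge0}c_k(G)x^k$. An induced subgraph $H$ of $Q_n$ isomorphic to some $Q_k$ has a unique vertex of minimal weight, called its bottom vertex. For an induced subgraph $G$ of $Q_n$ containing $0^n$,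 $c_{k,d}(G)$ is the number of induced subgraphs of $G$ isomorphic to $Q_k$ whose bottom vertex is at distance $d$ from $0^n$, and the distance cube polynomial is $D_G(x,q)=\sum_{k,d\ge 0}c_{k,d}(G)x^kq^d$. *)

theory Defs
  imports
    "Graph_Theory.Digraph_Component"
    "Graph_Theory.Digraph_Isomorphism"
    "Graph_Theory.Shortest_Path"
    "HOL-Library.Sublist"
    "HOL-Computational_Algebra.Computational_Algebra"
begin

text \<open>Binary strings are lists of Booleans, \<^const>\<open>True\<close> standing for the letter 1. An undirected
  simple graph is a symmetric digraph: the edge between \<open>u\<close> and \<open>v\<close> is the pair of arcs \<open>(u, v)\<close>
  and \<open>(v, u)\<close>.\<close>

definition hypercube :: "nat \<Rightarrow> (bool list, bool list \<times> bool list) pre_digraph" where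
  "hypercube n = \<lparr>
     verts = {u. length u = n},
     arcs = {(u, v). length u = n \<and> length v = n \<and> card {i. i < n \<and> u ! i \<noteq> v ! i} = 1},
     tail = fst,
     head = snd \<rparr>"

definition fibonacci_string :: "nat \<Rightarrow> bool list \<Rightarrow> bool" where
  "fibonacci_string p u \<longleftrightarrow> \<not> sublist (replicate p True) u"

definition fibonacci_cube :: "nat \<Rightarrow> nat \<Rightarrow> (bool list, bool list \<times> bool list) pre_digraph" where
  "fibonacci_cube p n = hypercube n \<restriction> {u \<in> verts (hypercube n). fibonacci_string p u}"

definition weight :: "bool list \<Rightarrow> nat" where
  "weight u = count_list u True"

definition induced_cubes :: "('a, 'b) pre_digraph \<Rightarrow> nat \<Rightarrow> ('a, 'b) pre_digraph set" where
  "induced_cubes G k = {H. induced_subgraph H G \<and> digraph_iso H (hypercube k)}"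

definition cube_count :: "('a, 'b) pre_digraph \<Rightarrow> nat \<Rightarrow> nat" where
  "cube_count G k = card (induced_cubes G k)"

text \<open>The sum runs over the support of the coefficients, which is finite for a finite graph.\<close>

definition cube_poly :: "('a, 'b) pre_digraph \<Rightarrow> int poly" where
  "cube_poly G = (\<Sum>k | cube_count G k \<noteq> 0. monom (int (cube_count G k)) k)"

text \<open>Meaningful for the induced hypercubes \<open>H\<close> of some \<^term>\<open>hypercube n\<close>, which have exactly one
  vertex of minimal weight.\<close>

definition bottom_vertex :: "(bool list, 'b) pre_digraph \<Rightarrow> bool list" where
  "bottom_vertex H = arg_min_on weight (verts H)"

text \<open>The distance in \<open>G\<close> is the least length of a walk, that is, its least cost when every arc
  has cost 1; it is infinite if there is no walk.\<close>

definition graph_dist :: "('a, 'b) pre_digraph \<Rightarrow> 'a \<Rightarrow> 'a \<Rightarrow> ereal" where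
  "graph_dist G u v = wf_digraph.\<mu> G (\<lambda>_. 1) u v"

text \<open>Here \<open>G\<close> is an induced subgraph of \<^term>\<open>hypercube n\<close> that contains the all-zero string.\<close>

definition cube_dist_count ::
  "nat \<Rightarrow> (bool list, bool list \<times> bool list) pre_digraph \<Rightarrow> nat \<Rightarrow> nat \<Rightarrow> nat" where
  "cube_dist_count n G k d =
     card {H \<in> induced_cubes G k.
       graph_dist G (replicate n False) (bottom_vertex H) = ereal (real d)}"

text \<open>As an element of the iterated polynomial ring \<open>\<int>[q][x]\<close>: the outer variable is \<open>x\<close>, the
  inner one is \<open>q\<close>.\<close>

definition dist_cube_poly ::
  "nat \<Rightarrow> (bool list, bool list \<times> bool list) pre_digraph \<Rightarrow> int poly poly" where
  "dist_cube_poly n G =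
     (\<Sum>(k, d) | cube_dist_count n G k d \<noteq> 0. monom (monom (int (cube_dist_count n G k d)) d) k)"

end

theory Submission
  imports Defs
begin

text \<open>An induced \<open>k\<close>-cube of the hypercube \<open>Q\<^sub>n\<close> is always a subcube: all strings that agree with a
  pattern over the letters 0, 1, \<open>*\<close> with exactly \<open>k\<close> stars (\<open>cube_embedding_image_is_subcube\<close>). The
  least string of a subcube replaces every star by 0, the greatest replaces every star by 1.
  Switching a 1 to 0 cannot create a run of 1s, so a subcube lies in the Fibonacci cube iff its
  greatest string is a Fibonacci string. For the same reason the 1s of a vertex of the Fibonacci cube
  can be removed one by one without leaving it, so its distance from the zero string is its weight,
  and the bottom vertex of a subcube lies at distance the number of letters 1 in the pattern. Hence
  both polynomials are sums over one set of patterns: a pattern contributes \<open>x\<close> for each star and,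
  for the distance polynomial, \<open>q\<close> for each letter 1 (\<open>cube_poly_fibonacci_cube\<close>,
  \<open>dist_cube_poly_fibonacci_cube\<close>).

  It remains to enumerate patterns in which fewer than \<open>p\<close> consecutive letters differ from 0, where
  such a letter has weight \<open>x + q\<close> in total. Let \<open>F\<^sub>r\<close> be the generating function of the patterns that
  are still admissible behind a run of \<open>r\<close> ones. The first letter is either 0, which resets the run,
  or a star or 1, which prolongs it, so \<open>F\<^sub>r = 1 + t F\<^sub>0 + t (x + q) F\<^sub>r\<^sub>+\<^sub>1\<close> for \<open>r < p\<close>, while \<open>F\<^sub>p = 0\<close>.
  Unrolling from \<open>r = 0\<close> gives \<open>F\<^sub>0 = S (1 + t F\<^sub>0)\<close> with \<open>S\<close> the geometric sum in the numerator, and the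
  claimed quotient follows; the cube polynomial is the case \<open>q = 1\<close>.\<close>

section \<open>Hamming distance and subcubes\<close>

text \<open>Defined by a filter so that it unfolds along the two lists, which the cardinality of a set of
  positions, as in the adjacency of hypercubes, does not.\<close>

definition hamming :: "bool list \<Rightarrow> bool list \<Rightarrow> nat" where
  "hamming u v = length (filter (\<lambda>(a, b). a \<noteq> b) (zip u v))"

text \<open>A pattern is a list over \<^term>\<open>Some False\<close>, \<^term>\<open>Some True\<close> and \<^term>\<open>None\<close>, which stand for the
  letters 0, 1 and \<open>*\<close>: \<^term>\<open>None\<close> marks a coordinate in which the subcube extends.\<close>

definition subcube :: "bool option list \<Rightarrow> bool list set" where
  "subcube w = {z. list_all2 (\<lambda>a c. a = None \<or> a = Some c) w z}"

definition bottom_string :: "bool option list \<Rightarrow> bool list" where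
  "bottom_string w = map (\<lambda>a. a = Some True) w"

definition top_string :: "bool option list \<Rightarrow> bool list" where
  "top_string w = map (\<lambda>a. a \<noteq> Some False) w"

abbreviation stars :: "bool option list \<Rightarrow> nat" where
  "stars w \<equiv> count_list w None"

abbreviation ones :: "bool option list \<Rightarrow> nat" where
  "ones w \<equiv> count_list w (Some True)"

lemma hamming_simps [simp]:
  "hamming [] v = 0"
  "hamming (a # u) (b # v) = (if a = b then 0 else 1) + hamming u v"
  by (auto simp: hamming_def)

lemma hamming_conv_card:
  assumes "length u = n" "length v = n"
  shows "card {i. i < n \<and> u ! i \<noteq> v ! i} = hamming u v"
proof -
  have "{i. i < n \<and> u ! i \<noteq> v ! i} = {i. i < length (zip u v) \<and> (case zip u v ! i of (a, b) \<Rightarrow> a \<noteq> b)}"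
    using assms by auto
  then show ?thesis unfolding hamming_def length_filter_conv_card by simp
qed

lemma hamming_self [simp]: "hamming u u = 0"
  by (induction u) auto

lemma hamming_eq_0_iff: "length u = length v \<Longrightarrow> hamming u v = 0 \<longleftrightarrow> u = v"
  by (induction u v rule: list_induct2) auto

lemma hamming_eq_1_obtains_flip:
  assumes "length u = length v" "hamming u v = 1"
  obtains i where "i < length u" "v = u[i := \<not> u ! i]"
proof -
  have "card {i. i < length u \<and> u ! i \<noteq> v ! i} = 1"
    unfolding hamming_conv_card[OF refl assms(1)[symmetric]] by (rule assms(2))
  then obtain i where i: "{i. i < length u \<and> u ! i \<noteq> v ! i} = {i}"
    by (auto simp: card_1_singleton_iff)
  have differ: "u ! l \<noteq> v ! l \<longleftrightarrow> l = i" if "l < length u" for l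
    using i that by blast
  have "i < length u" using i by blast
  moreover have "v = u[i := \<not> u ! i]"
  proof (rule nth_equalityI)
    show "v ! l = u[i := \<not> u ! i] ! l" if "l < length v" for l
      using differ[of l] that assms(1) by (cases "l = i") auto
  qed (use assms(1) in simp)
  ultimately show ?thesis using that by blast
qed

lemma weight_Cons [simp]: "weight (a # u) = (if a then 1 else 0) + weight u"
  by (simp add: weight_def)

lemma weight_Nil [simp]: "weight [] = 0"
  by (simp add: weight_def)

lemma weight_le_weight_plus_hamming:
  "length u = length v \<Longrightarrow> weight v \<le> weight u + hamming u v"
  by (induction u v rule: list_induct2) auto

lemma subcube_Nil [simp]: "subcube [] = {[]}"
  by (auto simp: subcube_def)

lemma mem_subcube_Cons [simp]:
  "z \<in> subcube (a # w) \<longleftrightarrow> (\<exists>c z'. z = c # z' \<and> (a = None \<or> a = Some c) \<and> z' \<in> subcube w)"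
  by (auto simp: subcube_def list_all2_Cons1)

lemma mem_subcube_iff_nth:
  "z \<in> subcube w \<longleftrightarrow> length z = length w \<and> (\<forall>i<length w. w ! i = None \<or> w ! i = Some (z ! i))"
  by (auto simp: subcube_def list_all2_conv_all_nth)

lemma mem_subcube_free_nth:
  assumes "J < length w"
  shows "z \<in> subcube (w[J := None]) \<longleftrightarrow>
    length z = length w \<and> (\<forall>i<length w. i = J \<or> w ! i = None \<or> w ! i = Some (z ! i))"
  using assms by (auto simp: mem_subcube_iff_nth nth_list_update)

lemma subcube_length: "z \<in> subcube w \<Longrightarrow> length z = length w"
  by (simp add: mem_subcube_iff_nth)

lemma bottom_in_subcube: "bottom_string w \<in> subcube w"
proof (induction w)
  case (Cons a w)
  then show ?case by (cases a) (auto simp: bottom_string_def)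
qed (simp add: bottom_string_def)

lemma top_in_subcube: "top_string w \<in> subcube w"
proof (induction w)
  case (Cons a w)
  then show ?case by (cases a) (auto simp: top_string_def)
qed (simp add: top_string_def)

text \<open>A letter of the pattern can be read off from the entries of the least and the greatest string of
  the subcube: they differ exactly at a star, and elsewhere both are the letter itself. Each of the
  two patterns therefore has to match the extreme strings of the other.\<close>

lemma subcube_eqD:
  assumes "subcube w = subcube w'"
  shows "w = w'"
proof -
  have "bottom_string w \<in> subcube w'" "top_string w \<in> subcube w'"
    "bottom_string w' \<in> subcube w" "top_string w' \<in> subcube w"
    using assms bottom_in_subcube top_in_subcube by blast+
  then show ?thesis
  proof (induction w arbitrary: w')
    case Nil
    then show ?case by (auto simp: bottom_string_def mem_subcube_iff_nth)
  next
    case (Cons a w)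
    then obtain b v where w': "w' = b # v"
      by (cases w') (auto simp: mem_subcube_iff_nth bottom_string_def)
    with Cons.prems have "w = v"
      by (intro Cons.IH) (auto simp: bottom_string_def top_string_def)
    moreover have "a = b"
      using Cons.prems w' by (cases a; cases b) (auto simp: bottom_string_def top_string_def)
    ultimately show ?case using w' by simp
  qed
qed

lemma weight_bottom: "weight (bottom_string w) = ones w"
  by (induction w) (auto simp: bottom_string_def)

text \<open>Another vertex of the subcube has a 1 at some star and the same letters as the bottom elsewhere.
  The minimum is strict, which makes the choice hidden in \<^const>\<open>arg_min_on\<close> determinate.\<close>

lemma weight_bottom_less:
  "z \<in> subcube w \<Longrightarrow> z \<noteq> bottom_string w \<Longrightarrow> weight (bottom_string w) < weight z"
proof (induction w arbitrary: z)
  case Nil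
  then show ?case by (simp add: bottom_string_def)
next
  case (Cons a w)
  then obtain c y where z: "z = c # y" "a = None \<or> a = Some c" "y \<in> subcube w" by auto
  show ?case
  proof (cases "y = bottom_string w")
    case True
    then show ?thesis using z Cons.prems by (auto simp: bottom_string_def)
  next
    case False
    then have "weight (bottom_string w) < weight y" using Cons.IH z by blast
    then show ?thesis using z by (auto simp: bottom_string_def)
  qed
qed

lemma arg_min_weight_subcube: "arg_min_on weight (subcube w) = bottom_string w"
  unfolding arg_min_on_def arg_min_def
proof (rule some_equality)
  show "is_arg_min weight (\<lambda>z. z \<in> subcube w) (bottom_string w)"
    using weight_bottom_less bottom_in_subcube by (auto simp: is_arg_min_def dest: less_asym)
next
  fix z assume "is_arg_min weight (\<lambda>z. z \<in> subcube w) z"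
  then show "z = bottom_string w"
    using weight_bottom_less bottom_in_subcube by (auto simp: is_arg_min_def)
qed

section \<open>Cubes embedded in hypercubes\<close>

text \<open>Reading only the starred coordinates is the isomorphism from a subcube onto a hypercube.\<close>

definition free_coords :: "bool option list \<Rightarrow> bool list \<Rightarrow> bool list" where
  "free_coords w z = map snd (filter (\<lambda>(a, c). a = None) (zip w z))"

lemma free_coords_simps [simp]:
  "free_coords [] z = []"
  "free_coords (a # w) (c # z) = (if a = None then c # free_coords w z else free_coords w z)"
  by (auto simp: free_coords_def)

lemma length_free_coords: "z \<in> subcube w \<Longrightarrow> length (free_coords w z) = stars w"
  by (induction w arbitrary: z) auto

text \<open>Two strings in a subcube can differ only at stars, so nothing is lost by dropping the rest.\<close>

lemma hamming_free_coords:
  "z \<in> subcube w \<Longrightarrow> z' \<in> subcube w \<Longrightarrow> hamming (free_coords w z) (free_coords w z') = hamming z z'"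
  by (induction w arbitrary: z z') auto

lemma free_coords_surj: "length s = stars w \<Longrightarrow> \<exists>z\<in>subcube w. free_coords w z = s"
proof (induction w arbitrary: s)
  case Nil
  then show ?case by simp
next
  case (Cons a w)
  show ?case
  proof (cases a)
    case None
    then obtain c s' where s: "s = c # s'" "length s' = stars w"
      using Cons.prems by (cases s) auto
    then obtain z where "z \<in> subcube w" "free_coords w z = s'" using Cons.IH by blast
    then show ?thesis using None s by (intro bexI[of _ "c # z"]) auto
  next
    case (Some c)
    then obtain z where "z \<in> subcube w" "free_coords w z = s" using Cons by auto
    then show ?thesis using Some by (intro bexI[of _ "c # z"]) auto
  qed
qed

lemma bij_betw_free_coords: "bij_betw (free_coords w) (subcube w) {s. length s = stars w}"
  unfolding bij_betw_def
proof
  show "inj_on (free_coords w) (subcube w)"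
  proof (rule inj_onI)
    fix z z' assume "z \<in> subcube w" "z' \<in> subcube w" "free_coords w z = free_coords w z'"
    then have "hamming z z' = 0" by (metis hamming_free_coords hamming_self)
    then show "z = z'" using \<open>z \<in> subcube w\<close> \<open>z' \<in> subcube w\<close>
      by (simp add: hamming_eq_0_iff subcube_length)
  qed
  show "free_coords w ` subcube w = {s. length s = stars w}"
    using free_coords_surj by (force simp: length_free_coords)
qed

text \<open>Hypercubes are connected: change the tail first, along the face of a fixed first letter, and then
  the first letter.\<close>

lemma constant_if_constant_on_edges:
  assumes "\<And>s s'. length s = k \<Longrightarrow> length s' = k \<Longrightarrow> hamming s s' = 1 \<Longrightarrow> f s = f s'"
  shows "length s = k \<Longrightarrow> length s' = k \<Longrightarrow> f s = f s'"
  using assms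
proof (induction k arbitrary: f s s')
  case 0
  then show ?case by simp
next
  case (Suc k)
  then obtain a t b t' where s: "s = a # t" "s' = b # t'" "length t = k" "length t' = k"
    by (auto simp: length_Suc_conv)
  have "f (a # t) = f (a # t')"
    using s by (intro Suc.IH[of t t' "\<lambda>t. f (a # t)"]) (auto intro!: Suc.prems(3))
  also have "\<dots> = f (b # t')"
    using s Suc.prems(3)[of "a # t'" "b # t'"] by (cases "a = b") auto
  finally show ?case using s by simp
qed

text \<open>Opposite edges of a 4-cycle in a hypercube flip the same coordinate. From \<open>u\<close> the cycle leaves by
  flipping \<open>i\<close> and \<open>j\<close>, and it closes by flipping \<open>j'\<close> and \<open>m\<close>. The two middle vertices differ, so
  \<open>i \<noteq> j\<close>, and the fourth vertex is not \<open>u\<close>, so \<open>i \<noteq> j'\<close>. Hence \<open>i\<close> is flipped once on one way round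
  and must be \<open>m\<close> on the other, which leaves \<open>j\<close> as the partner of \<open>j'\<close>.\<close>

lemma square_parallel_flips:
  assumes "i < length u" "j < length u" "j' < length u" "m < length u"
    and "u[i := \<not> u ! i] \<noteq> u[j := \<not> u ! j]"
    and sq: "(u[i := \<not> u ! i])[j' := \<not> u[i := \<not> u ! i] ! j'] = (u[j := \<not> u ! j])[m := \<not> u[j := \<not> u ! j] ! m]"
    and "(u[i := \<not> u ! i])[j' := \<not> u[i := \<not> u ! i] ! j'] \<noteq> u"
  shows "j' = j"
proof -
  have "i \<noteq> j" "j' \<noteq> i" using assms by auto
  from arg_cong[OF sq, of "\<lambda>l. l ! i"] have "m = i"
    using assms(1-4) \<open>i \<noteq> j\<close> \<open>j' \<noteq> i\<close> by (auto simp: nth_list_update split: if_splits)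
  from arg_cong[OF sq, of "\<lambda>l. l ! j'"] show ?thesis
    using assms(1-4) \<open>i \<noteq> j\<close> \<open>j' \<noteq> i\<close> \<open>m = i\<close> by (auto simp: nth_list_update split: if_splits)
qed

text \<open>Split the cube along its first coordinate. The face of strings that start with 0 maps onto a subcube
  by induction, and the image of the other face arises from it by flipping one coordinate in each
  vertex. Across an edge of the face this coordinate does not change, because the edge and its copy
  span a 4-cycle; as the face is connected, it is the same coordinate \<open>J\<close> everywhere. By injectivity
  \<open>J\<close> is not yet a star of the subcube, so that the whole image is the subcube with \<open>J\<close> starred.\<close>

lemma cube_embedding_image_is_subcube:
  assumes "inj_on \<phi> {s. length s = k}"
    and "\<And>s. length s = k \<Longrightarrow> length (\<phi> s) = n"
    and "\<And>s s'. length s = k \<Longrightarrow> length s' = k \<Longrightarrow> hamming s s' = 1 \<Longrightarrow> hamming (\<phi> s) (\<phi> s') = 1"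
  shows "\<exists>w. length w = n \<and> stars w = k \<and> \<phi> ` {s. length s = k} = subcube w"
  using assms
proof (induction k arbitrary: \<phi>)
  case 0
  let ?w = "map Some (\<phi> [])"
  have "subcube ?w = {\<phi> []}"
    by (auto simp: mem_subcube_iff_nth intro: nth_equalityI)
  moreover have "stars ?w = 0" by (auto simp: count_list_0_iff)
  ultimately show ?case using "0.prems"(2)[of "[]"] by (intro exI[of _ ?w]) auto
next
  case (Suc k)
  let ?L = "\<lambda>s. \<phi> (False # s)" and ?R = "\<lambda>s. \<phi> (True # s)"
  have injD: "u = v" if "\<phi> u = \<phi> v" "length u = Suc k" "length v = Suc k" for u v
    using Suc.prems(1) that by (auto dest: inj_onD)
  have "\<exists>w. length w = n \<and> stars w = k \<and> ?L ` {s. length s = k} = subcube w"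
    using Suc.prems(2,3) by (intro Suc.IH) (auto intro!: inj_onI dest: injD)
  then obtain w where w: "length w = n" "stars w = k" "?L ` {s. length s = k} = subcube w"
    by blast
  have "\<exists>j<n. ?R s = (?L s)[j := \<not> ?L s ! j]" if "length s = k" for s
  proof -
    have "length (?L s) = n" "length (?R s) = n" "hamming (?L s) (?R s) = 1"
      using that Suc.prems(2,3) by simp_all
    then show ?thesis by (metis hamming_eq_1_obtains_flip)
  qed
  then obtain j where j: "\<And>s. length s = k \<Longrightarrow> j s < n"
      "\<And>s. length s = k \<Longrightarrow> ?R s = (?L s)[j s := \<not> ?L s ! j s]"
    by metis
  have j_edge: "j s' = j s" if s: "length s = k" "length s' = k" "hamming s s' = 1" for s s'
  proof -
    have len: "length (?L s) = n" "length (?L s') = n" "length (?R s) = n" "length (?R s') = n"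
      using Suc.prems(2) s by auto
    have "hamming (?L s) (?L s') = 1" using Suc.prems(3) s by auto
    then obtain i where i: "i < n" "?L s' = (?L s)[i := \<not> ?L s ! i]"
      using len by (metis hamming_eq_1_obtains_flip)
    have "hamming (?R s) (?R s') = 1" using Suc.prems(3) s by auto
    then obtain m where m: "m < n" "?R s' = (?R s)[m := \<not> ?R s ! m]"
      using len by (metis hamming_eq_1_obtains_flip)
    have ne: "?L s' \<noteq> ?R s" "?R s' \<noteq> ?L s" using s by (auto dest: injD)
    show ?thesis
    proof (rule square_parallel_flips)
      show "i < length (?L s)" "j s < length (?L s)" "j s' < length (?L s)" "m < length (?L s)"
        using i m j s len by auto
      show "(?L s)[i := \<not> ?L s ! i] \<noteq> (?L s)[j s := \<not> ?L s ! j s]"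
        using ne i j s by metis
      show "(?L s)[i := \<not> ?L s ! i, j s' := \<not> (?L s)[i := \<not> ?L s ! i] ! j s'] =
          (?L s)[j s := \<not> ?L s ! j s, m := \<not> (?L s)[j s := \<not> ?L s ! j s] ! m]"
        using i(2) m(2) j(2) s by metis
      show "(?L s)[i := \<not> ?L s ! i, j s' := \<not> (?L s)[i := \<not> ?L s ! i] ! j s'] \<noteq> ?L s"
        using ne(2) i(2) j(2) s by metis
    qed
  qed
  define J where "J = j (replicate k False)"
  have J: "j s = J" if "length s = k" for s
    unfolding J_def by (rule constant_if_constant_on_edges[of k]) (use that in \<open>auto simp: j_edge\<close>)
  have "J < n" using j(1)[of "replicate k False"] by (simp add: J_def)
  have R: "?R s = (?L s)[J := \<not> ?L s ! J]" if "length s = k" for s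
    using j(2)[OF that] J[OF that] by simp
  \<comment> \<open>a starred \<open>J\<close> would put a vertex of the second face into the image of the first\<close>
  have "w ! J \<noteq> None"
  proof
    assume None: "w ! J = None"
    let ?s = "replicate k False"
    have "?L ?s \<in> subcube w" unfolding w(3)[symmetric] by (rule imageI) simp
    then have "?R ?s \<in> subcube w"
      using None R[of ?s]
      by (auto simp: mem_subcube_iff_nth) (metis nth_list_update_neq)
    then have "?R ?s \<in> ?L ` {s. length s = k}" unfolding w(3) .
    then obtain s where "length s = k" "?R ?s = ?L s" by blast
    then show False by (auto dest: injD)
  qed
  then obtain c where c: "w ! J = Some c" by auto
  let ?w = "w[J := None]"
  have "stars ?w = Suc k"
  proof -
    have "w = take J w @ w ! J # drop (Suc J) w" "?w = take J w @ None # drop (Suc J) w"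
      using \<open>J < n\<close> w(1) by (simp_all add: id_take_nth_drop upd_conv_take_nth_drop)
    then have "stars w = stars (take J w) + stars (drop (Suc J) w)"
      "stars ?w = stars (take J w) + Suc (stars (drop (Suc J) w))"
      using c by (metis count_list.simps(2) count_list_append option.distinct(1),
                  metis count_list.simps(2) count_list_append add_Suc_right Suc_eq_plus1)
    then show ?thesis using w(2) by simp
  qed
  moreover have "\<phi> ` {s. length s = Suc k} = subcube ?w"
  proof -
    have "{s. length s = Suc k} = (#) False ` {s. length s = k} \<union> (#) True ` {s. length s = k}"
      by (force simp: length_Suc_conv)
    then have "\<phi> ` {s. length s = Suc k} = ?L ` {s. length s = k} \<union> ?R ` {s. length s = k}"
      by (simp add: image_Un image_image)
    also have "?R ` {s. length s = k} = (\<lambda>z. z[J := \<not> z ! J]) ` subcube w"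
      unfolding w(3)[symmetric] image_image using R by (intro image_cong) auto
    also have "?L ` {s. length s = k} \<union> \<dots> = subcube ?w"
      unfolding w(3)
    proof (intro equalityI subsetI)
      fix z assume "z \<in> subcube w \<union> (\<lambda>z. z[J := \<not> z ! J]) ` subcube w"
      then show "z \<in> subcube ?w"
        using \<open>J < n\<close> w(1) by (subst mem_subcube_free_nth) (auto simp: mem_subcube_iff_nth)
    next
      fix z assume z: "z \<in> subcube ?w"
      then have z': "length z = n" "\<And>i. i < n \<Longrightarrow> i = J \<or> w ! i = None \<or> w ! i = Some (z ! i)"
        using \<open>J < n\<close> w(1) by (auto simp: mem_subcube_free_nth)
      show "z \<in> subcube w \<union> (\<lambda>z. z[J := \<not> z ! J]) ` subcube w"
      proof (cases "z ! J = c")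
        case True
        then have "z \<in> subcube w" using z' c w(1) by (auto simp: mem_subcube_iff_nth)
        then show ?thesis by simp
      next
        case False
        let ?y = "z[J := \<not> z ! J]"
        have "?y ! i = (if i = J then c else z ! i)" if "i < n" for i
          using that False z'(1) by (auto simp: nth_list_update)
        then have "?y \<in> subcube w" using z' c w(1) by (auto simp: mem_subcube_iff_nth)
        moreover have "z = ?y[J := \<not> ?y ! J]"
          using z'(1) \<open>J < n\<close> by simp
        ultimately show ?thesis by blast
      qed
    qed
    finally show ?thesis .
  qed
  ultimately show ?case using w(1) by (intro exI[of _ ?w]) simp
qed

section \<open>Induced cubes of the Fibonacci cube\<close>

lemma hypercube_simps [simp]:
  "verts (hypercube n) = {u. length u = n}"
  "tail (hypercube n) = fst" "head (hypercube n) = snd"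
  by (auto simp: hypercube_def)

lemma arcs_hypercube:
  "arcs (hypercube n) = {(u, v). length u = n \<and> length v = n \<and> hamming u v = 1}"
proof -
  have "card {i. i < n \<and> u ! i \<noteq> v ! i} = 1 \<longleftrightarrow> hamming u v = 1"
    if "length u = n" "length v = n" for u v
    unfolding hamming_conv_card[OF that] ..
  then show ?thesis unfolding hypercube_def by (simp del: One_nat_def) blast
qed

lemma wf_induced_hypercube: "V \<subseteq> {z. length z = n} \<Longrightarrow> wf_digraph (hypercube n \<restriction> V)"
  by unfold_locales auto

text \<open>Hypercubes have no parallel arcs, so the arc part of a digraph isomorphism is forced by the vertex
  part, and an isomorphism amounts to a bijection that preserves and reflects adjacency.\<close>

lemma induced_hypercube_iso_iff:
  assumes V: "V \<subseteq> {z. length z = n}"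
  shows "digraph_iso (hypercube n \<restriction> V) (hypercube k) \<longleftrightarrow>
    (\<exists>f. bij_betw f V {s. length s = k} \<and> (\<forall>u\<in>V. \<forall>v\<in>V. hamming (f u) (f v) = 1 \<longleftrightarrow> hamming u v = 1))"
    (is "?iso \<longleftrightarrow> ?bij")
proof
  let ?H = "hypercube n \<restriction> V"
  have arcs_H: "(u, v) \<in> arcs ?H \<longleftrightarrow> u \<in> V \<and> v \<in> V \<and> hamming u v = 1" for u v
    using V by (auto simp: arcs_hypercube induce_subgraph_def)
  have tail_H: "tail ?H = fst" "head ?H = snd"
    by (auto simp: induce_subgraph_def)
  {
    assume ?iso
    then obtain h where h: "pre_digraph.digraph_isomorphism ?H h" "hypercube k = app_iso h ?H"
      by (auto simp: digraph_iso_def)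
    let ?f = "iso_verts h"
    have inj: "inj_on ?f V" using h(1) by (auto simp: pre_digraph.digraph_isomorphism_def)
    have "verts (hypercube k) = ?f ` V" using h(2) by simp
    then have bij: "bij_betw ?f V {s. length s = k}" using inj by (simp add: bij_betw_def)
    have ends: "iso_arcs h (u, v) = (?f u, ?f v)"
      if "(u, v) \<in> arcs ?H" for u v
    proof -
      have "iso_tail h = fst" "iso_head h = snd"
        using arg_cong[OF h(2), of tail] arg_cong[OF h(2), of head] by auto
      then show ?thesis using h(1) that tail_H
        unfolding pre_digraph.digraph_isomorphism_def by (metis fst_conv snd_conv prod.collapse)
    qed
    have arcs_img: "arcs (hypercube k) = iso_arcs h ` arcs ?H" using h(2) by simp
    have "hamming (?f u) (?f v) = 1 \<longleftrightarrow> hamming u v = 1" if uv: "u \<in> V" "v \<in> V" for u v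
    proof
      assume "hamming u v = 1"
      then have a: "(u, v) \<in> arcs ?H" using arcs_H uv by blast
      then have "(?f u, ?f v) \<in> arcs (hypercube k)"
        unfolding arcs_img ends[OF a, symmetric] by (rule imageI)
      then show "hamming (?f u) (?f v) = 1" by (simp add: arcs_hypercube)
    next
      assume "hamming (?f u) (?f v) = 1"
      then have "(?f u, ?f v) \<in> arcs (hypercube k)"
        using bij uv by (auto simp: arcs_hypercube bij_betw_def)
      then obtain u' v' where a: "(u', v') \<in> arcs ?H" "iso_arcs h (u', v') = (?f u, ?f v)"
        unfolding arcs_img by (auto elim!: imageE)
      then have "?f u' = ?f u" "?f v' = ?f v" using ends[OF a(1)] by auto
      then have "u' = u" "v' = v" using inj a(1) arcs_H uv by (auto dest: inj_onD)
      then show "hamming u v = 1" using a(1) arcs_H by blast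
    qed
    with bij show ?bij by blast
  }
  {
    assume ?bij
    then obtain f where f: "bij_betw f V {s. length s = k}"
        "\<And>u v. u \<in> V \<Longrightarrow> v \<in> V \<Longrightarrow> hamming (f u) (f v) = 1 \<longleftrightarrow> hamming u v = 1" by blast
    have inj: "inj_on f V" and img: "f ` V = {s. length s = k}" using f(1) by (auto simp: bij_betw_def)
    define h where "h = \<lparr>iso_verts = f, iso_arcs = map_prod f f, iso_head = snd, iso_tail = fst\<rparr>"
    have "inj_on (map_prod f f) (arcs ?H)"
      using inj arcs_H by (auto intro!: inj_onI dest: inj_onD)
    then have "pre_digraph.digraph_isomorphism ?H h"
      using inj wf_induced_hypercube[OF V] tail_H
      by (auto simp: pre_digraph.digraph_isomorphism_def h_def)
    moreover have "map_prod f f ` arcs ?H = arcs (hypercube k)"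
    proof (intro equalityI subsetI)
      fix e assume "e \<in> map_prod f f ` arcs ?H"
      then show "e \<in> arcs (hypercube k)"
        using arcs_H f(2) img by (auto simp: arcs_hypercube)
    next
      fix e assume "e \<in> arcs (hypercube k)"
      then obtain s t where "e = (s, t)" "s \<in> f ` V" "t \<in> f ` V" "hamming s t = 1"
        unfolding img by (auto simp: arcs_hypercube)
      then obtain u v where uv: "e = map_prod f f (u, v)" "u \<in> V" "v \<in> V" "hamming (f u) (f v) = 1"
        by auto
      then have "(u, v) \<in> arcs ?H" using arcs_H f(2) by blast
      then show "e \<in> map_prod f f ` arcs ?H" unfolding uv(1) by (rule imageI)
    qed
    then have "hypercube k = app_iso h ?H"
      using img by (intro pre_digraph.equality) (auto simp: h_def)
    ultimately show ?iso by (auto simp: digraph_iso_def)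
  }
qed

text \<open>A run of \<open>p\<close> ones in the smaller string is also one in the larger string.\<close>

lemma fibonacci_string_antimono:
  assumes "list_all2 (\<le>) u v" "fibonacci_string p v"
  shows "fibonacci_string p u"
  unfolding fibonacci_string_def
proof
  assume "sublist (replicate p True) u"
  then obtain xs ys where "u = xs @ replicate p True @ ys" by (auto simp: sublist_def)
  with assms(1) obtain xs' zs ys' where v: "v = xs' @ zs @ ys'" "list_all2 (\<le>) (replicate p True) zs"
    by (auto simp: list_all2_append1)
  then have "zs = replicate p True"
    by (auto simp: list_all2_conv_all_nth intro: nth_equalityI)
  then show False using assms(2) v(1) by (simp add: fibonacci_string_def)
qed

lemma le_top: "z \<in> subcube w \<Longrightarrow> list_all2 (\<le>) z (top_string w)"
  by (auto simp: mem_subcube_iff_nth list_all2_conv_all_nth top_string_def)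

definition fibonacci_patterns :: "nat \<Rightarrow> nat \<Rightarrow> bool option list set" where
  "fibonacci_patterns p n = {w. length w = n \<and> fibonacci_string p (top_string w)}"

lemma verts_fibonacci_cube: "verts (fibonacci_cube p n) = {u. length u = n \<and> fibonacci_string p u}"
  by (simp add: fibonacci_cube_def)

lemma tail_fibonacci_cube: "tail (fibonacci_cube p n) = fst"
  by (simp add: fibonacci_cube_def)

lemma head_fibonacci_cube: "head (fibonacci_cube p n) = snd"
  by (simp add: fibonacci_cube_def)

lemma arcs_fibonacci_cube:
  "arcs (fibonacci_cube p n) =
    {(u, v). u \<in> verts (fibonacci_cube p n) \<and> v \<in> verts (fibonacci_cube p n) \<and> hamming u v = 1}"
  by (auto simp: fibonacci_cube_def induce_subgraph_def arcs_hypercube)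

text \<open>The greatest string of a subcube decides, since Fibonacci strings are closed under switching 1s
  to 0.\<close>

lemma subcube_subset_fibonacci_iff:
  assumes "length w = n"
  shows "subcube w \<subseteq> verts (fibonacci_cube p n) \<longleftrightarrow> w \<in> fibonacci_patterns p n"
  using assms top_in_subcube fibonacci_string_antimono[OF le_top] subcube_length
  by (fastforce simp: verts_fibonacci_cube fibonacci_patterns_def)

lemma fibonacci_cube_induce:
  "V \<subseteq> verts (fibonacci_cube p n) \<Longrightarrow> fibonacci_cube p n \<restriction> V = hypercube n \<restriction> V"
  by (auto simp: fibonacci_cube_def induce_subgraph_def)

lemma wf_fibonacci_cube: "wf_digraph (fibonacci_cube p n)"
  unfolding fibonacci_cube_def by (rule wf_induced_hypercube) auto

text \<open>An induced cube of the Fibonacci cube is an induced subgraph of the hypercube as well, where the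
  inverse of the isomorphism is an embedding to which the classification of embedded cubes applies.\<close>

lemma induced_cubes_fibonacci_cube:
  "induced_cubes (fibonacci_cube p n) k =
    (\<lambda>w. hypercube n \<restriction> subcube w) ` {w \<in> fibonacci_patterns p n. stars w = k}"
proof (intro equalityI subsetI)
  fix H assume H: "H \<in> induced_cubes (fibonacci_cube p n) k"
  let ?V = "verts H"
  interpret G: wf_digraph "fibonacci_cube p n" by (rule wf_fibonacci_cube)
  have ind: "induced_subgraph H (fibonacci_cube p n)" using H by (simp add: induced_cubes_def)
  then have V: "?V \<subseteq> verts (fibonacci_cube p n)" by (auto simp: induced_subgraph_def subgraph_def)
  then have V': "?V \<subseteq> {z. length z = n}" by (auto simp: verts_fibonacci_cube)
  have "H = fibonacci_cube p n \<restriction> ?V"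
    using ind by (auto simp: induced_subgraph_def subgraph_def induce_subgraph_def compatible_def)
  then have HV: "H = hypercube n \<restriction> ?V" using fibonacci_cube_induce[OF V] by simp
  moreover have "digraph_iso H (hypercube k)" using H by (simp add: induced_cubes_def)
  ultimately obtain f where f: "bij_betw f ?V {s. length s = k}"
      "\<And>u v. u \<in> ?V \<Longrightarrow> v \<in> ?V \<Longrightarrow> hamming (f u) (f v) = 1 \<longleftrightarrow> hamming u v = 1"
    using induced_hypercube_iso_iff[OF V', of k] by metis
  let ?g = "inv_into ?V f"
  have g: "bij_betw ?g {s. length s = k} ?V" using f(1) by (rule bij_betw_inv_into)
  have gV: "?g s \<in> ?V" if "length s = k" for s using g that by (auto simp: bij_betw_def)
  have fg: "f (?g s) = s" if "length s = k" for s using f(1) that by (simp add: bij_betw_inv_into_right)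
  have "\<exists>w. length w = n \<and> stars w = k \<and> ?g ` {s. length s = k} = subcube w"
  proof (rule cube_embedding_image_is_subcube)
    show "inj_on ?g {s. length s = k}" using g by (simp add: bij_betw_def)
    show "length (?g s) = n" if "length s = k" for s using gV[OF that] V' by blast
    show "hamming (?g s) (?g s') = 1" if "length s = k" "length s' = k" "hamming s s' = 1" for s s'
      using f(2)[OF gV gV] fg that by simp
  qed
  then obtain w where w: "length w = n" "stars w = k" "?V = subcube w"
    using g by (auto simp: bij_betw_def)
  then have "w \<in> fibonacci_patterns p n" using V subcube_subset_fibonacci_iff by metis
  then show "H \<in> (\<lambda>w. hypercube n \<restriction> subcube w) ` {w \<in> fibonacci_patterns p n. stars w = k}"
    using w HV by auto
next
  fix H assume "H \<in> (\<lambda>w. hypercube n \<restriction> subcube w) ` {w \<in> fibonacci_patterns p n. stars w = k}"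
  then obtain w where w: "w \<in> fibonacci_patterns p n" "stars w = k" "H = hypercube n \<restriction> subcube w"
    by blast
  interpret G: wf_digraph "fibonacci_cube p n" by (rule wf_fibonacci_cube)
  have len: "length w = n" using w(1) by (simp add: fibonacci_patterns_def)
  have V: "subcube w \<subseteq> verts (fibonacci_cube p n)"
    using w(1) subcube_subset_fibonacci_iff[OF len] by blast
  then have V': "subcube w \<subseteq> {z. length z = n}" by (auto simp: verts_fibonacci_cube)
  have "induced_subgraph H (fibonacci_cube p n)"
    using V w(3) fibonacci_cube_induce[OF V] G.induced_induce by metis
  moreover have "digraph_iso H (hypercube k)"
    unfolding w(3) induced_hypercube_iso_iff[OF V']
    using bij_betw_free_coords[of w] w(2)
    by (intro exI[of _ "free_coords w"]) (simp add: hamming_free_coords)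
  ultimately show "H \<in> induced_cubes (fibonacci_cube p n) k" by (simp add: induced_cubes_def)
qed

lemma inj_induced_subcube: "inj_on (\<lambda>w. hypercube n \<restriction> subcube w) A"
  by (rule inj_onI) (drule arg_cong[of _ _ verts], simp add: subcube_eqD)

section \<open>Distance from the zero string\<close>

text \<open>A potential that rises by at most 1 along each arc bounds the length of walks from below; weight is
  such a potential on a subgraph of a hypercube.\<close>

lemma (in wf_digraph) awalk_cost_ge_potential:
  fixes f :: "'a \<Rightarrow> nat"
  assumes "\<And>e. e \<in> arcs G \<Longrightarrow> f (head G e) \<le> f (tail G e) + 1"
  shows "awalk u es v \<Longrightarrow> real (f v) \<le> real (f u) + awalk_cost (\<lambda>_. 1) es"
proof (induction es arbitrary: u)
  case Nil
  then show ?case by (simp add: awalk_Nil_iff)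
next
  case (Cons e es)
  then have e: "e \<in> arcs G" "tail G e = u" "awalk (head G e) es v"
    by (auto simp: awalk_Cons_iff)
  with Cons.IH[OF e(3)] assms[OF e(1)] show ?case by simp
qed

text \<open>Erase one letter 1. The neighbour lies below \<open>v\<close>, so it is a Fibonacci string whenever \<open>v\<close> is.\<close>

lemma obtain_lower_neighbour:
  assumes "weight v = Suc m"
  obtains u where "length u = length v" "hamming u v = 1" "weight u = m" "list_all2 (\<le>) u v"
proof -
  have "\<exists>u. length u = length v \<and> hamming u v = 1 \<and> weight u = m \<and> list_all2 (\<le>) u v"
    using assms
  proof (induction v arbitrary: m)
    case Nil
    then show ?case by simp
  next
    case (Cons a v)
    show ?case
    proof (cases a)
      case True
      then show ?thesis using Cons.prems
        by (intro exI[of _ "False # v"]) (auto simp: list_all2_refl)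
    next
      case False
      then have "weight v = Suc m" using Cons.prems by simp
      from Cons.IH[OF this] obtain u
        where "length u = length v" "hamming u v = 1" "weight u = m" "list_all2 (\<le>) u v" by blast
      then show ?thesis using False by (intro exI[of _ "False # u"]) (auto simp del: le_bool_def)
    qed
  qed
  then show ?thesis using that by blast
qed

lemma weight_eq_0_iff: "weight v = 0 \<longleftrightarrow> v = replicate (length v) False"
  by (induction v) auto

lemma fibonacci_cube_walk_from_zero:
  assumes "v \<in> verts (fibonacci_cube p n)"
  shows "\<exists>es. pre_digraph.awalk (fibonacci_cube p n) (replicate n False) es v \<and>
    wf_digraph.awalk_cost (\<lambda>_. 1) es = real (weight v)"
  using assms
proof (induction "weight v" arbitrary: v)
  case 0
  interpret G: wf_digraph "fibonacci_cube p n" by (rule wf_fibonacci_cube)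
  have "v = replicate n False" using 0 weight_eq_0_iff[of v] by (simp add: verts_fibonacci_cube)
  then show ?case using 0 by (intro exI[of _ "[]"]) (auto simp: G.awalk_Nil_iff)
next
  case (Suc m)
  interpret G: wf_digraph "fibonacci_cube p n" by (rule wf_fibonacci_cube)
  obtain u where u: "length u = length v" "hamming u v = 1" "weight u = m" "list_all2 (\<le>) u v"
    using Suc.hyps(2) by (metis obtain_lower_neighbour)
  then have uV: "u \<in> verts (fibonacci_cube p n)"
    using Suc.prems fibonacci_string_antimono by (auto simp: verts_fibonacci_cube)
  with Suc.hyps(1) u obtain es where es: "G.awalk (replicate n False) es u"
      "G.awalk_cost (\<lambda>_. 1) es = real (weight u)" by blast
  have "(u, v) \<in> arcs (fibonacci_cube p n)"
    using uV Suc.prems u(2) by (simp add: arcs_fibonacci_cube)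
  then have "G.awalk u [(u, v)] v"
    using uV by (simp add: G.awalk_def tail_fibonacci_cube head_fibonacci_cube)
  then have "G.awalk (replicate n False) (es @ [(u, v)]) v" using es(1) by (metis G.awalk_appendI)
  then show ?case using es(2) u(3) Suc.hyps(2) by (intro exI[of _ "es @ [(u, v)]"]) auto
qed

lemma graph_dist_fibonacci_cube:
  assumes v: "v \<in> verts (fibonacci_cube p n)"
  shows "graph_dist (fibonacci_cube p n) (replicate n False) v = ereal (real (weight v))"
proof -
  interpret G: wf_digraph "fibonacci_cube p n" by (rule wf_fibonacci_cube)
  obtain es where es: "G.awalk (replicate n False) es v" "G.awalk_cost (\<lambda>_. 1) es = real (weight v)"
    using fibonacci_cube_walk_from_zero[OF v] by blast
  have edge: "weight (head (fibonacci_cube p n) e) \<le> weight (tail (fibonacci_cube p n) e) + 1"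
    if e: "e \<in> arcs (fibonacci_cube p n)" for e
  proof -
    obtain u u' where "e = (u, u')" by fastforce
    with e weight_le_weight_plus_hamming[of u u'] show ?thesis
      by (simp add: arcs_fibonacci_cube verts_fibonacci_cube tail_fibonacci_cube head_fibonacci_cube)
  qed
  have "weight (replicate n False) = 0" by (simp add: weight_eq_0_iff)
  then have "real (weight v) \<le> G.awalk_cost (\<lambda>_. 1) es'" if "G.awalk (replicate n False) es' v" for es'
    using G.awalk_cost_ge_potential[of weight, OF edge that] by simp
  then have "ereal (real (weight v)) \<le> G.\<mu> (\<lambda>_. 1) (replicate n False) v"
    unfolding G.\<mu>_def by (intro INF_greatest) simp
  moreover have "G.\<mu> (\<lambda>_. 1) (replicate n False) v \<le> ereal (real (weight v))"
    using G.min_cost_le_walk_cost[OF es(1), of "\<lambda>_. 1"] es(2) by simp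
  ultimately show ?thesis unfolding graph_dist_def by (rule antisym[rotated])
qed

section \<open>Polynomials as sums over patterns\<close>

lemma finite_fibonacci_patterns: "finite (fibonacci_patterns p n)"
proof (rule finite_subset)
  show "fibonacci_patterns p n \<subseteq> {w. set w \<subseteq> UNIV \<and> length w = n}"
    by (auto simp: fibonacci_patterns_def)
qed (rule finite_lists_length_eq, simp)

lemma cube_count_fibonacci_cube:
  "cube_count (fibonacci_cube p n) k = card {w \<in> fibonacci_patterns p n. stars w = k}"
  unfolding cube_count_def induced_cubes_fibonacci_cube
  by (rule card_image) (rule inj_induced_subcube)

lemma cube_dist_count_fibonacci_cube:
  "cube_dist_count n (fibonacci_cube p n) k d =
    card {w \<in> fibonacci_patterns p n. (stars w, ones w) = (k, d)}"
proof -
  let ?G = "fibonacci_cube p n" and ?I = "\<lambda>w. hypercube n \<restriction> subcube w"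
  have dist: "graph_dist ?G (replicate n False) (bottom_vertex (?I w)) = ereal (real (ones w))"
    if "w \<in> fibonacci_patterns p n" for w
  proof -
    have "length w = n" using that by (simp add: fibonacci_patterns_def)
    then have "bottom_string w \<in> verts ?G"
      using that bottom_in_subcube subcube_subset_fibonacci_iff by blast
    then show ?thesis
      by (simp add: bottom_vertex_def arg_min_weight_subcube graph_dist_fibonacci_cube weight_bottom)
  qed
  have "{H \<in> induced_cubes ?G k. graph_dist ?G (replicate n False) (bottom_vertex H) = ereal (real d)}
      = ?I ` {w \<in> fibonacci_patterns p n. (stars w, ones w) = (k, d)}"
    unfolding induced_cubes_fibonacci_cube using dist by auto
  then show ?thesis unfolding cube_dist_count_def by (simp add: card_image inj_induced_subcube)
qed

text \<open>Grouping a finite sum by the value of \<open>f\<close>, with \<open>g k c\<close> in the role of a monomial with exponent \<open>k\<close>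
  and coefficient \<open>c\<close>. The left-hand side ranges over the nonzero counts, as in the definitions of the
  two polynomials.\<close>

lemma sum_over_fibre_cards:
  fixes g :: "'b \<Rightarrow> int \<Rightarrow> 'c :: comm_monoid_add"
  assumes "finite P" and g: "\<And>k a b. g k (a + b) = g k a + g k b" "\<And>k. g k 0 = 0"
  shows "(\<Sum>k | card {w \<in> P. f w = k} \<noteq> 0. g k (int (card {w \<in> P. f w = k}))) = (\<Sum>w\<in>P. g (f w) 1)"
proof -
  have card_g: "(\<Sum>w\<in>A. g k 1) = g k (int (card A))" if "finite A" for k and A :: "'a set"
    using that by (induction A) (simp_all add: g)
  have "{k. card {w \<in> P. f w = k} \<noteq> 0} = f ` P"
    using assms(1) by (auto simp: card_eq_0_iff)
  moreover have "g k (int (card {w \<in> P. f w = k})) = (\<Sum>w\<in>{w \<in> P. f w = k}. g (f w) 1)" for k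
  proof -
    have "(\<Sum>w\<in>{w \<in> P. f w = k}. g (f w) 1) = (\<Sum>w\<in>{w \<in> P. f w = k}. g k 1)"
      by (rule sum.cong) auto
    then show ?thesis using assms(1) by (simp add: card_g)
  qed
  ultimately show ?thesis using sum.image_gen[OF assms(1), of "\<lambda>w. g (f w) 1" f] by simp
qed

lemma cube_poly_fibonacci_cube:
  "cube_poly (fibonacci_cube p n) = (\<Sum>w\<in>fibonacci_patterns p n. [:0, 1:] ^ stars w)"
  unfolding cube_poly_def cube_count_fibonacci_cube
  by (subst sum_over_fibre_cards[where g = "\<lambda>k c. monom c k"])
     (simp_all add: finite_fibonacci_patterns add_monom, simp add: monom_altdef)

lemma dist_cube_poly_fibonacci_cube:
  "dist_cube_poly n (fibonacci_cube p n) =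
    (\<Sum>w\<in>fibonacci_patterns p n. [:0, 1:] ^ stars w * [:[:0, 1:]:] ^ ones w)"
proof -
  have "monom (monom 1 d) k = [:0, 1:] ^ k * [:[:0, 1 :: int:]:] ^ d" for k d
    by (simp add: monom_altdef poly_const_pow)
  moreover have "dist_cube_poly n (fibonacci_cube p n) =
      (\<Sum>kd | card {w \<in> fibonacci_patterns p n. (stars w, ones w) = kd} \<noteq> 0.
        monom (monom (int (card {w \<in> fibonacci_patterns p n. (stars w, ones w) = kd})) (snd kd)) (fst kd))"
    unfolding dist_cube_poly_def cube_dist_count_fibonacci_cube
    by (simp only: case_prod_unfold prod.collapse)
  ultimately show ?thesis
    by (subst (asm) sum_over_fibre_cards[where g = "\<lambda>kd c. monom (monom c (snd kd)) (fst kd)"])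
       (simp_all add: finite_fibonacci_patterns add_monom)
qed

section \<open>Generating function\<close>

text \<open>The parameter \<open>r\<close> is the length of the run of ones that precedes the pattern: the part of the past on which
  the admissible continuations depend.\<close>

definition pattern_sum :: "nat \<Rightarrow> 'a::comm_ring_1 \<Rightarrow> 'a \<Rightarrow> nat \<Rightarrow> nat \<Rightarrow> 'a" where
  "pattern_sum p x q r n =
    (\<Sum>w | length w = n \<and> fibonacci_string p (replicate r True @ top_string w). x ^ stars w * q ^ ones w)"

lemma fibonacci_string_replicate: "fibonacci_string p (replicate r True) \<longleftrightarrow> r < p"
proof -
  have "sublist (replicate p True) (replicate r True) \<longleftrightarrow> p \<le> r"
  proof
    assume "sublist (replicate p True) (replicate r True)"
    then show "p \<le> r" by (auto dest: sublist_length_le)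
  next
    assume "p \<le> r"
    then have "replicate r True = replicate p True @ replicate (r - p) True"
      by (simp add: replicate_add[symmetric])
    then show "sublist (replicate p True) (replicate r True)" by simp
  qed
  then show ?thesis by (simp add: fibonacci_string_def not_le)
qed

text \<open>A run of ones cannot extend across the letter 0, so it lies on one side of it.\<close>

lemma fibonacci_string_run_False:
  "fibonacci_string p (replicate r True @ False # u) \<longleftrightarrow> r < p \<and> fibonacci_string p u"
proof -
  have split: False if "replicate p True = xs @ False # ys" for xs ys
    using that by (metis in_set_conv_decomp in_set_replicate)
  have "sublist (replicate p True) (False # u) \<longleftrightarrow> sublist (replicate p True) u"
    using split[of "[]"] by (auto simp: sublist_Cons_right prefix_Cons)
  moreover have "sublist (replicate p True) (replicate r True @ False # u) \<longleftrightarrow>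
      sublist (replicate p True) (replicate r True) \<or> sublist (replicate p True) (False # u)"
  proof -
    have "xs2 = []" if "replicate p True = xs1 @ xs2" "prefix xs2 (False # u)" for xs1 xs2
      using that split by (auto simp: prefix_Cons)
    then show ?thesis unfolding sublist_append by (metis append_Nil2 suffix_imp_sublist)
  qed
  ultimately show ?thesis
    using fibonacci_string_replicate[of p r] by (auto simp: fibonacci_string_def)
qed

lemma pattern_sum_0: "r < p \<Longrightarrow> pattern_sum p x q r 0 = 1"
proof -
  assume "r < p"
  then have "{w. length w = 0 \<and> fibonacci_string p (replicate r True @ top_string w)} = {[]}"
    by (auto simp: top_string_def fibonacci_string_replicate)
  then show ?thesis by (simp add: pattern_sum_def)
qed

text \<open>A first letter 0 ends the run and contributes no factor; a star contributes \<open>x\<close>, a letter 1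
  contributes \<open>q\<close>, and both make the run one longer.\<close>

lemma pattern_sum_Suc:
  assumes "r < p"
  shows "pattern_sum p x q r (Suc n) =
    pattern_sum p x q 0 n + (x + q) * pattern_sum p x q (Suc r) n"
proof -
  let ?A = "\<lambda>r n. {w. length w = n \<and> fibonacci_string p (replicate r True @ top_string w)}"
  have fin: "finite (?A r n)" for r n
    by (rule finite_subset[OF _ finite_lists_length_eq[of UNIV n]]) auto
  have top_Cons: "top_string (Some False # w) = False # top_string w"
      "top_string (None # w) = True # top_string w"
      "top_string (Some True # w) = True # top_string w" for w
    by (simp_all add: top_string_def)
  have app: "replicate r True @ True # u = replicate (Suc r) True @ u" for u
    by (simp add: replicate_append_same replicate_app_Cons_same)
  have mem: "Some False # w \<in> ?A r (Suc n) \<longleftrightarrow> w \<in> ?A 0 n"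
      "None # w \<in> ?A r (Suc n) \<longleftrightarrow> w \<in> ?A (Suc r) n"
      "Some True # w \<in> ?A r (Suc n) \<longleftrightarrow> w \<in> ?A (Suc r) n" for w
    using assms by (simp_all add: top_Cons fibonacci_string_run_False app del: replicate_Suc)
  have "?A r (Suc n) = (#) (Some False) ` ?A 0 n \<union> ((#) None ` ?A (Suc r) n \<union> (#) (Some True) ` ?A (Suc r) n)"
    (is "?L = ?R")
  proof (rule set_eqI)
    fix v :: "bool option list"
    show "v \<in> ?L \<longleftrightarrow> v \<in> ?R"
    proof (cases v)
      case Nil
      then show ?thesis by auto
    next
      case (Cons a w)
      consider "a = None" | "a = Some True" | "a = Some False" by (cases a) auto
      then show ?thesis
        by cases (use Cons mem[of w] in \<open>auto simp del: replicate.simps\<close>)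
    qed
  qed
  moreover have "sum h ((#) (Some False) ` A \<union> ((#) None ` B \<union> (#) (Some True) ` B)) =
      (\<Sum>w\<in>A. h (Some False # w)) + ((\<Sum>w\<in>B. h (None # w)) + (\<Sum>w\<in>B. h (Some True # w)))"
    if "finite A" "finite B" for A B and h :: "bool option list \<Rightarrow> 'a"
    using that
    by (subst sum.union_disjoint, simp, simp, blast)
       (subst sum.union_disjoint, simp, simp, blast, simp add: sum.reindex)
  ultimately have "pattern_sum p x q r (Suc n) =
      (\<Sum>w\<in>?A 0 n. x ^ stars (Some False # w) * q ^ ones (Some False # w)) +
      ((\<Sum>w\<in>?A (Suc r) n. x ^ stars (None # w) * q ^ ones (None # w)) +
       (\<Sum>w\<in>?A (Suc r) n. x ^ stars (Some True # w) * q ^ ones (Some True # w)))"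
    unfolding pattern_sum_def using fin by (simp only:)
  also have "\<dots> = pattern_sum p x q 0 n + (x + q) * pattern_sum p x q (Suc r) n"
    by (simp add: pattern_sum_def sum_distrib_left algebra_simps flip: sum.distrib)
  finally show ?thesis .
qed

lemma pattern_sum_full_run: "pattern_sum p x q p n = 0"
proof -
  have "\<not> fibonacci_string p (replicate p True @ u)" for u
    by (simp add: fibonacci_string_def)
  then show ?thesis by (simp add: pattern_sum_def)
qed

text \<open>Over a field the power series quotient is characterised by a product, because \<open>1 - t S\<close> has constant
  coefficient 1 and so is nonzero.\<close>

lemma pattern_sum_gf:
  fixes x q :: "'a::field"
  assumes S_def: "S = (\<Sum>i<p. fps_const ((x + q) ^ i) * fps_X ^ i)"
  shows "Abs_fps (pattern_sum p x q 0) = S / (1 - fps_X * S)"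
proof -
  define F where "F r = Abs_fps (pattern_sum p x q r)" for r
  define y where "y = fps_const (x + q) * fps_X"
  have step: "F r = (1 + fps_X * F 0) + y * F (Suc r)" if "r < p" for r
  proof (rule fps_ext)
    fix n show "F r $ n = ((1 + fps_X * F 0) + y * F (Suc r)) $ n"
      using that by (cases n) (simp_all add: F_def y_def mult.assoc pattern_sum_0 pattern_sum_Suc)
  qed
  \<comment> \<open>unrolling \<open>step\<close> \<open>r\<close> times; at \<open>r = p\<close> the remainder \<open>F p\<close> vanishes\<close>
  have iter: "r \<le> p \<Longrightarrow> F 0 = (\<Sum>i<r. y ^ i) * (1 + fps_X * F 0) + y ^ r * F r" for r
  proof (induction r)
    case (Suc r)
    then show ?case using step[of r] by (simp add: algebra_simps)
  qed simp
  have S: "S = (\<Sum>i<p. y ^ i)"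
    by (simp add: S_def y_def power_mult_distrib fps_const_power)
  have "F p = 0" by (rule fps_ext) (simp add: F_def pattern_sum_full_run)
  then have "F 0 = S * (1 + fps_X * F 0)" using iter[of p] S by simp
  then have "F 0 * (1 - fps_X * S) = S" by (simp add: algebra_simps)
  moreover have "1 - fps_X * S \<noteq> 0"
  proof
    assume "1 - fps_X * S = 0"
    then have "(1 - fps_X * S) $ 0 = 0" by simp
    then show False by simp
  qed
  ultimately show ?thesis unfolding F_def[symmetric]
    by (metis nonzero_mult_div_cancel_right)
qed

lemma pattern_sum_initial:
  "pattern_sum p x q 0 n = (\<Sum>w\<in>fibonacci_patterns p n. x ^ stars w * q ^ ones w)"
  by (simp add: pattern_sum_def fibonacci_patterns_def)

lemma to_fract_power: "to_fract (a ^ n) = to_fract a ^ n"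
  by (induction n) simp_all

theorem corollary6p4:
  fixes p :: nat
  assumes "p \<ge> 2"
  shows "(let x = to_fract [:0, 1:] :: int poly fract;
              S = (\<Sum>i<p. fps_const ((x + 1) ^ i) * fps_X ^ i)
          in Abs_fps (\<lambda>n. to_fract (cube_poly (fibonacci_cube p n))) = S / (1 - fps_X * S))
       \<and> (let x = to_fract [:0, 1:] :: int poly poly fract;
              q = to_fract [:[:0, 1:]:];
              S = (\<Sum>i<p. fps_const ((x + q) ^ i) * fps_X ^ i)
          in Abs_fps (\<lambda>n. to_fract (dist_cube_poly n (fibonacci_cube p n))) = S / (1 - fps_X * S))"
proof -
  have "to_fract (cube_poly (fibonacci_cube p n)) = pattern_sum p (to_fract [:0, 1:]) 1 0 n" for n
    by (simp add: cube_poly_fibonacci_cube pattern_sum_initial to_fract_sum to_fract_power)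
  moreover have "to_fract (dist_cube_poly n (fibonacci_cube p n)) =
      pattern_sum p (to_fract [:0, 1:]) (to_fract [:[:0, 1:]:]) 0 n" for n
    by (simp add: dist_cube_poly_fibonacci_cube pattern_sum_initial to_fract_sum to_fract_power)
  ultimately show ?thesis unfolding Let_def by (simp add: pattern_sum_gf)
qed

end
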